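(* Let $S$ be a topologically periodic Hausdorff topological semigroup. If $S$ is inversely regular and countably compact, then: (i) the inversion $\operatorname{inv}\colon H(S)\to H(S)$ is continuous; (ii) the projection $\pi\colon H(S)\to E(S)$ is continuous.
   Context: A topological semigroup is a topological space with a continuous associative binary operation. A space $X$ is countably compact if every countable open cover of $X$ has a finite subcover. $E(S)$ denotes the set of idempotents of a semigroup $S$; for $e\in E(S)$, $H(e)$ is the maximal subgroup of $S$ with identity $e$; $H(S)=\bigcup_{e\in E(S)}H(e)$. The inversion $\operatorname{inv}\colon H(S)\to H(S)$ sends $x\in H(e)$ to its inverse $x^{-1}$ in the group $H(e)$, and the projection $\pi\colon H(S)\to E(S)$ is $\pi(x)=xx^{-1}$; $H(S)$ and $E(S)$ carry the subspace topologies from $S$. For $A\subseteq H(S)$, $A^{-1}=\{a^{-1}\mid a\in A\}$, and $\overline{A}$ denotes the closure of $A$ in $S$. An element $x\in S$ is topologically periodic if for any open neighbourhood $U(x)$ of $x$ there is an integer $n\geqslant 2$ with $x^n\in U(x)$; $S$ is topologically periodic if every element of $S$ is. $S$ is inversely regular at $e\in E(S)$ if for any open neighbourhood $U(e)$ of $e$ in $S$ there is an open neighbourhood $W(e)$ of $e$ in $S$ such that $\overline{(W(e)\cap H(S))^{-1}}\subseteq (U(e)\cap H(S))^{-1}$. A topological semigroup $S$ with $E(S)\neq\varnothing$ is inversely regular if it is inversely regular at each of its idempotents. *)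

theory Defs
  imports "HOL-Analysis.Analysis" "HOL-Algebra.Group"
begin

text \<open>
  The ambient semigroup \<open>S\<close> is the whole of a type \<open>'a\<close>. Joint continuity of the multiplication is
  the class \<^class>\<open>topological_semigroup_mult\<close>, the Hausdorff axiom is \<^class>\<open>t2_space\<close>, and
  countable compactness of \<open>S\<close> is \<^const>\<open>countably_compact\<close> of the universe of \<open>'a\<close>.
\<close>

definition idempotents :: "'a::semigroup_mult set" where
  "idempotents = {e. e * e = e}"

definition group_on :: "'a::semigroup_mult set \<Rightarrow> 'a \<Rightarrow> 'a monoid" where
  "group_on G e = \<lparr>carrier = G, monoid.mult = (*), one = e\<rparr>"

text \<open>
  The maximal subgroup with identity \<open>e\<close>: the largest set, with respect to inclusion, that is a
  group under the multiplication of \<open>S\<close> with identity \<open>e\<close>. It exists for every idempotent \<open>e\<close>; see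
  \<open>group_maximal_subgroup\<close> and \<open>maximal_subgroup_greatest\<close> below.
\<close>

definition maximal_subgroup :: "'a::semigroup_mult \<Rightarrow> 'a set" where
  "maximal_subgroup e = (GREATEST G. group (group_on G e))"

definition clifford_part :: "'a::semigroup_mult set" where
  "clifford_part = (\<Union>e\<in>idempotents. maximal_subgroup e)"

text \<open>
  Distinct maximal subgroups are disjoint, so the description below determines a unique element for
  every \<open>x\<close> in \<^const>\<open>clifford_part\<close>; see \<open>inversion_eq\<close>. Off that set the value is unspecified.
\<close>

definition inversion :: "'a::semigroup_mult \<Rightarrow> 'a" where
  "inversion x = (THE y. \<exists>e\<in>idempotents. x \<in> maximal_subgroup e \<and>
     y = m_inv (group_on (maximal_subgroup e) e) x)"

definition projection :: "'a::semigroup_mult \<Rightarrow> 'a" where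
  "projection x = x * inversion x"

text \<open>
  A semigroup need not have a unit, so the power operation of \<^class>\<open>monoid_mult\<close> is not available.
  Only exponents \<open>n \<ge> 1\<close> are meaningful; the value at \<open>0\<close> is a dummy.
\<close>

definition semigroup_power :: "'a::semigroup_mult \<Rightarrow> nat \<Rightarrow> 'a" where
  "semigroup_power x n = (((*) x) ^^ (n - 1)) x"

definition topologically_periodic_at :: "'a::topological_semigroup_mult \<Rightarrow> bool" where
  "topologically_periodic_at x \<longleftrightarrow>
     (\<forall>U. open U \<and> x \<in> U \<longrightarrow> (\<exists>n\<ge>2. semigroup_power x n \<in> U))"

definition topologically_periodic :: "'a::topological_semigroup_mult itself \<Rightarrow> bool" where
  "topologically_periodic TYPE('a) \<longleftrightarrow> (\<forall>x::'a. topologically_periodic_at x)"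

definition inversely_regular_at :: "'a::topological_semigroup_mult \<Rightarrow> bool" where
  "inversely_regular_at e \<longleftrightarrow>
     (\<forall>U. open U \<and> e \<in> U \<longrightarrow>
       (\<exists>W. open W \<and> e \<in> W \<and>
         closure (inversion ` (W \<inter> clifford_part)) \<subseteq> inversion ` (U \<inter> clifford_part)))"

definition inversely_regular :: "'a::topological_semigroup_mult itself \<Rightarrow> bool" where
  "inversely_regular TYPE('a) \<longleftrightarrow>
     (idempotents :: 'a set) \<noteq> {} \<and> (\<forall>e\<in>(idempotents :: 'a set). inversely_regular_at e)"

lemma group_on_simps [simp]:
  "carrier (group_on G e) = G"
  "monoid.mult (group_on G e) = (*)"
  "one (group_on G e) = e"
  by (simp_all add: group_on_def)

lemma semigroup_power_simps:
  "semigroup_power x (Suc 0) = x"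
  "semigroup_power x (Suc (Suc n)) = x * semigroup_power x (Suc n)"
  by (simp_all add: semigroup_power_def)

lemma group_on_iff:
  "group (group_on G e) \<longleftrightarrow>
     (\<forall>x\<in>G. \<forall>y\<in>G. x * y \<in> G) \<and> e \<in> G \<and> (\<forall>x\<in>G. e * x = x \<and> x * e = x) \<and>
     (\<forall>x\<in>G. \<exists>y\<in>G. x * y = e \<and> y * x = e)" (is "?L \<longleftrightarrow> ?R")
proof
  assume ?L
  then interpret group "group_on G e" .
  have "\<exists>y\<in>G. x * y = e \<and> y * x = e" if "x \<in> G" for x
    using that r_inv[of x] l_inv[of x] inv_closed[of x] by auto
  then show ?R
    using m_closed one_closed l_one r_one by simp
next
  assume ?R
  then show ?L
    by (intro groupI) (auto simp: mult.assoc)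
qed

lemma maximal_subgroup_aux:
  fixes e :: "'a::semigroup_mult"
  assumes "e \<in> idempotents"
  defines "M \<equiv> {x. e * x = x \<and> x * e = x \<and>
                   (\<exists>y. e * y = y \<and> y * e = y \<and> x * y = e \<and> y * x = e)}"
  shows "group (group_on M e)" and "group (group_on G e) \<Longrightarrow> G \<subseteq> M"
proof -
  have e: "e * e = e" using assms by (simp add: idempotents_def)
  have "x * y \<in> M" if xy: "x \<in> M" "y \<in> M" for x y
  proof -
    obtain x' where x': "e * x' = x'" "x' * e = x'" "x * x' = e" "x' * x = e"
      using xy by (auto simp: M_def)
    obtain y' where y': "e * y' = y'" "y' * e = y'" "y * y' = e" "y' * y = e"
      using xy by (auto simp: M_def)
    have x: "e * x = x" "x * e = x" and y: "e * y = y" "y * e = y"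
      using xy by (auto simp: M_def)
    have "e * (x * y) = x * y" "x * y * e = x * y"
      using x y by (simp add: mult.assoc [symmetric], simp add: mult.assoc)
    moreover have "e * (y' * x') = y' * x'" "y' * x' * e = y' * x'"
      using x' y' by (simp add: mult.assoc [symmetric], simp add: mult.assoc)
    moreover have "x * y * (y' * x') = e"
    proof -
      have "x * y * (y' * x') = x * (y * y') * x'" by (simp only: mult.assoc)
      then show ?thesis using x x' y' by simp
    qed
    moreover have "y' * x' * (x * y) = e"
    proof -
      have "y' * x' * (x * y) = y' * (x' * x) * y" by (simp only: mult.assoc)
      then show ?thesis using y x' y' by simp
    qed
    ultimately show ?thesis unfolding M_def by blast
  qed
  moreover have "e \<in> M" using e by (auto simp: M_def)
  moreover have "\<exists>y\<in>M. x * y = e \<and> y * x = e" if "x \<in> M" for x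
    using that by (auto simp: M_def)
  ultimately show "group (group_on M e)"
    unfolding group_on_iff by (auto simp: M_def)
  show "G \<subseteq> M" if "group (group_on G e)"
    using that unfolding group_on_iff M_def by blast
qed

lemma maximal_subgroup_eq:
  fixes e :: "'a::semigroup_mult"
  assumes "e \<in> idempotents"
  shows "maximal_subgroup e = {x. e * x = x \<and> x * e = x \<and>
                   (\<exists>y. e * y = y \<and> y * e = y \<and> x * y = e \<and> y * x = e)}"
  unfolding maximal_subgroup_def
  by (rule Greatest_equality; rule maximal_subgroup_aux[OF assms])

lemma group_maximal_subgroup:
  "e \<in> idempotents \<Longrightarrow> group (group_on (maximal_subgroup e) e)"
  using maximal_subgroup_aux(1) by (simp only: maximal_subgroup_eq)

lemma maximal_subgroup_greatest:
  "e \<in> idempotents \<Longrightarrow> group (group_on G e) \<Longrightarrow> G \<subseteq> maximal_subgroup e"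
  using maximal_subgroup_aux(2) by (simp only: maximal_subgroup_eq)

lemma maximal_subgroup_disjoint:
  assumes "e \<in> idempotents" "f \<in> idempotents" "x \<in> maximal_subgroup e" "x \<in> maximal_subgroup f"
  shows "e = f"
proof -
  obtain y where y: "x * y = e" "y * x = e" "e * x = x" "x * e = x"
    using assms by (auto simp: maximal_subgroup_eq)
  obtain z where z: "x * z = f" "z * x = f" "f * x = x" "x * f = x"
    using assms by (auto simp: maximal_subgroup_eq)
  have "e = f * x * y" using y z by simp
  also have "\<dots> = f * e" using y by (simp only: mult.assoc)
  also have "\<dots> = z * (x * e)" using z by (simp only: mult.assoc [symmetric])
  also have "\<dots> = f" using y z by simp
  finally show ?thesis .
qed

lemma inversion_eq:
  assumes "e \<in> idempotents" "x \<in> maximal_subgroup e"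
  shows "inversion x = m_inv (group_on (maximal_subgroup e) e) x"
  unfolding inversion_def
proof (rule the_equality)
  fix y
  assume "\<exists>f\<in>idempotents. x \<in> maximal_subgroup f \<and> y = m_inv (group_on (maximal_subgroup f) f) x"
  then show "y = m_inv (group_on (maximal_subgroup e) e) x"
    using maximal_subgroup_disjoint assms by auto
qed (use assms in blast)

lemma projection_eq:
  assumes "e \<in> idempotents" "x \<in> maximal_subgroup e"
  shows "projection x = e"
  using group.r_inv[OF group_maximal_subgroup[OF assms(1)], of x] assms
  by (simp add: projection_def inversion_eq)

end

theory Submission
  imports Defs
begin

text \<open>
  Inversion is continuous at every idempotent \<open>e\<close>: given a neighbourhood \<open>U\<close> of \<open>e\<close>, choose
  neighbourhoods \<open>W\<^sub>0 = U, W\<^sub>1, \<dots>\<close> of \<open>e\<close> with \<open>W\<^sub>n\<^sub>+\<^sub>1 W\<^sub>n\<^sub>+\<^sub>1 \<subseteq> W\<^sub>n\<close> and the closure of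
  \<open>(W\<^sub>n\<^sub>+\<^sub>1 \<inter> H(S))\<^sup>-\<^sup>1\<close> contained in \<open>(W\<^sub>n \<inter> H(S))\<^sup>-\<^sup>1\<close>. If no \<open>(W\<^sub>n \<inter> H(S))\<^sup>-\<^sup>1\<close> lies in \<open>U\<close>, countable
  compactness yields a point \<open>x \<notin> U\<close> of \<open>F = (K \<inter> H(S))\<^sup>-\<^sup>1\<close>, where \<open>K\<close> is the intersection of the \<open>W\<^sub>n\<close>.
  As \<open>K\<close> is a subsemigroup, \<open>F\<close> contains all positive powers of \<open>x\<close>; it is closed, and periodicity puts
  \<open>x\<^sup>-\<^sup>1\<close> into the closure of these powers. Hence \<open>x\<^sup>-\<^sup>1 \<in> F\<close>, that is \<open>x \<in> K \<subseteq> U\<close>, a contradiction.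

  At an arbitrary \<open>x \<in> H(S)\<close> choose \<open>k\<close> with \<open>x\<^sup>k\<close> close to \<open>x\<^sup>-\<^sup>1\<close> and \<open>x\<^sup>k\<^sup>+\<^sup>1\<close> close to \<open>x x\<^sup>-\<^sup>1\<close>; then
  \<open>z\<^sup>-\<^sup>1 = z\<^sup>k (z\<^sup>k\<^sup>+\<^sup>1)\<^sup>-\<^sup>1\<close> is close to \<open>x\<^sup>-\<^sup>1\<close> for all \<open>z \<in> H(S)\<close> near \<open>x\<close>.
\<close>

section \<open>Group inverses described by equations\<close>

text \<open>An equational form of "\<open>x\<close> lies in H(S) and \<open>y\<close> is its group
  inverse" that names no idempotent; the next lemmas prove both directions.\<close>

definition commuting_inverse :: "'a::semigroup_mult \<Rightarrow> 'a \<Rightarrow> bool" where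
  "commuting_inverse x y \<longleftrightarrow> x * y = y * x \<and> x * y * x = x \<and> y * x * y = y"

lemma commuting_inverse_sym: "commuting_inverse x y \<Longrightarrow> commuting_inverse y x"
  by (auto simp: commuting_inverse_def)

lemma commuting_inverse_inversion:
  assumes "x \<in> clifford_part"
  shows "commuting_inverse x (inversion x)"
proof -
  obtain e where e: "e \<in> idempotents" "x \<in> maximal_subgroup e"
    using assms by (auto simp: clifford_part_def)
  interpret G: group "group_on (maximal_subgroup e) e"
    by (rule group_maximal_subgroup[OF e(1)])
  have "inversion x \<in> maximal_subgroup e" "x * inversion x = e" "inversion x * x = e"
    using e G.inv_closed[of x] G.r_inv[of x] G.l_inv[of x] by (simp_all add: inversion_eq)
  then show ?thesis
    using e G.l_one[of x] G.l_one[of "inversion x"] by (simp add: commuting_inverse_def)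
qed

text \<open>The product \<open>x * y\<close> is an idempotent and a two-sided identity for
  \<open>x\<close> and \<open>y\<close>, so both lie in its maximal subgroup, where inverses are
  unique.\<close>

lemma commuting_inverse_imp:
  assumes "commuting_inverse x y"
  shows "x \<in> clifford_part" "inversion x = y"
proof -
  define e where "e = x * y"
  have comm: "x * y = y * x" and xyx: "x * y * x = x" and yxy: "y * x * y = y"
    using assms by (auto simp: commuting_inverse_def)
  have "x * (x * y) = x" "y * (x * y) = y"
    unfolding comm by (metis comm xyx mult.assoc, metis comm yxy mult.assoc)
  then have xy: "x * y = e" "y * x = e" "e * x = x" "e * y = y" "x * e = x" "y * e = y"
    using comm xyx yxy by (simp_all add: e_def)
  have "e * e = e * x * y" by (simp add: e_def mult.assoc)
  then have e: "e \<in> idempotents" using xy by (simp add: idempotents_def)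
  have x: "x \<in> maximal_subgroup e" and y: "y \<in> maximal_subgroup e"
    using xy by (auto simp: maximal_subgroup_eq[OF e])
  show "x \<in> clifford_part" using e x by (auto simp: clifford_part_def)
  interpret G: group "group_on (maximal_subgroup e) e"
    by (rule group_maximal_subgroup[OF e])
  show "inversion x = y"
    using G.inv_equality[of y x] x y xy by (simp add: inversion_eq[OF e x])
qed

lemma inversion_in_clifford_part: "x \<in> clifford_part \<Longrightarrow> inversion x \<in> clifford_part"
  and inversion_inversion: "x \<in> clifford_part \<Longrightarrow> inversion (inversion x) = x"
  using commuting_inverse_imp[OF commuting_inverse_sym[OF commuting_inverse_inversion]] by auto

lemma projection_in_idempotents:
  assumes "x \<in> clifford_part" shows "projection x \<in> idempotents"
  using assms by (auto simp: clifford_part_def projection_eq)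

section \<open>Powers and their inverses\<close>

lemma semigroup_power_Suc: "n \<ge> 1 \<Longrightarrow> semigroup_power x (Suc n) = x * semigroup_power x n"
  by (cases n) (simp_all add: semigroup_power_simps)

lemma semigroup_power_commute:
  assumes "n \<ge> 1" "x * y = y * x"
  shows "semigroup_power x n * y = y * semigroup_power x n"
  using assms(1)
proof (induction n rule: dec_induct)
  case base
  then show ?case using assms by (simp add: semigroup_power_simps)
next
  case (step n)
  have "x * (y * semigroup_power x n) = y * (x * semigroup_power x n)"
    using assms(2) by (simp flip: mult.assoc)
  with step show ?case by (simp add: semigroup_power_Suc mult.assoc)
qed

lemma commuting_inverse_power:
  assumes xy: "commuting_inverse x y" and n: "n \<ge> 1"
  shows "commuting_inverse (semigroup_power x n) (semigroup_power y n)"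
    and "semigroup_power x n * semigroup_power y n = x * y"
proof -
  have comm: "x * y = y * x" and xyx: "x * y * x = x" and yxy: "y * x * y = y"
    using xy by (auto simp: commuting_inverse_def)
  show prod: "semigroup_power x n * semigroup_power y n = x * y"
    using n
  proof (induction n rule: dec_induct)
    case base
    then show ?case by (simp add: semigroup_power_simps)
  next
    case (step n)
    have "semigroup_power x (Suc n) * semigroup_power y (Suc n)
        = x * (semigroup_power x n * y) * semigroup_power y n"
      using step by (simp add: semigroup_power_Suc mult.assoc)
    also have "\<dots> = x * y * (semigroup_power x n * semigroup_power y n)"
      using semigroup_power_commute[OF step(1) comm] by (simp add: mult.assoc)
    also have "\<dots> = x * y * x * y"
      using step by (simp add: mult.assoc)
    finally show ?case using xyx by simp
  qed
  \<comment> \<open>Used for \<open>(x, y)\<close> and for \<open>(y, x)\<close>: the common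
    idempotent is a left identity for the powers of both.\<close>
  have absorb: "u * v * semigroup_power u n = semigroup_power u n" if "u * v * u = u" for u v :: 'a
    using n
  proof (induction n rule: dec_induct)
    case base
    then show ?case using that by (simp add: semigroup_power_simps)
  next
    case (step n)
    then show ?case using that by (simp add: semigroup_power_Suc flip: mult.assoc)
  qed
  have "semigroup_power y n * x = x * semigroup_power y n"
    using semigroup_power_commute[OF n, of y x] comm by simp
  then have "semigroup_power x n * semigroup_power y n = semigroup_power y n * semigroup_power x n"
    using semigroup_power_commute[OF n, of x "semigroup_power y n"] by simp
  then show "commuting_inverse (semigroup_power x n) (semigroup_power y n)"
    using absorb[OF xyx] absorb[OF yxy] prod comm
    by (simp add: commuting_inverse_def)
qed

text \<open>Cancellation rules in place of negative exponents; all exponents stay positive, away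
  from the dummy value at \<open>0\<close>.\<close>

lemma semigroup_power_times_inverse:
  assumes "commuting_inverse x y" "n \<ge> 1"
  shows "semigroup_power x (Suc (Suc n)) * y * y = semigroup_power x n"
    and "semigroup_power x (Suc n) * y = semigroup_power x n * x * y"
    and "semigroup_power x n * x * y = semigroup_power x n"
proof -
  have comm: "x * y = y * x" and xyx: "x * y * x = x"
    using assms by (auto simp: commuting_inverse_def)
  show absorb: "semigroup_power x n * x * y = semigroup_power x n"
    using assms(2)
  proof (induction n rule: dec_induct)
    case base
    then show ?case using xyx comm by (simp add: semigroup_power_simps) (metis mult.assoc)
  next
    case (step n)
    then show ?case by (simp add: semigroup_power_Suc mult.assoc)
  qed
  have Suc: "semigroup_power x (Suc m) * y = semigroup_power x m * x * y" if "m \<ge> 1" for m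
    using that semigroup_power_commute[OF that, of x x] by (simp add: semigroup_power_Suc)
  show "semigroup_power x (Suc n) * y = semigroup_power x n * x * y"
    by (rule Suc[OF assms(2)])
  have "semigroup_power x (Suc (Suc n)) * y = x * (semigroup_power x (Suc n) * y)"
    using assms by (simp add: semigroup_power_Suc mult.assoc)
  also have "\<dots> = semigroup_power x (Suc n)"
    using assms Suc absorb by (simp add: semigroup_power_Suc)
  finally show "semigroup_power x (Suc (Suc n)) * y * y = semigroup_power x n"
    using assms Suc absorb by simp
qed

section \<open>Continuity, periodicity and countable compactness\<close>

lemma continuous_on_semigroup_power:
  "n \<ge> 1 \<Longrightarrow> continuous_on A (\<lambda>x::'a::topological_semigroup_mult. semigroup_power x n)"
  by (induction n rule: dec_induct)
     (auto simp: semigroup_power_simps semigroup_power_Suc intro!: continuous_intros)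

lemma open_times_neighbourhoods:
  fixes a b :: "'a::topological_semigroup_mult"
  assumes "open U" "a * b \<in> U"
  obtains A B where "open A" "open B" "a \<in> A" "b \<in> B" "\<And>x y. x \<in> A \<Longrightarrow> y \<in> B \<Longrightarrow> x * y \<in> U"
proof -
  have "open ((\<lambda>p::'a \<times> 'a. fst p * snd p) -` U)"
    using assms by (intro open_vimage continuous_intros)
  with assms show thesis
    by (elim open_prod_elim[of _ "(a, b)"]) (use that in fastforce)+
qed

text \<open>Periodicity only provides exponents \<open>\<ge> 2\<close>; when the exponent is \<open>2\<close>, the identity \<open>x y\<close>
  itself lies in the neighbourhood and is approximated a second time.\<close>

lemma inverse_near_power:
  fixes x :: "'a::topological_semigroup_mult"
  assumes per: "topologically_periodic_at x" and xy: "commuting_inverse x y"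
    and U: "open U" "y \<in> U"
  obtains n where "n \<ge> 1" "semigroup_power x n \<in> U"
proof -
  have eqs: "x * y = y * x" "x * y * x = x" "y * x * y = y"
    using xy by (auto simp: commuting_inverse_def)
  have near: "\<exists>n\<ge>2. semigroup_power x n \<in> V" if "open V" "x \<in> V" for V
    using per that by (auto simp: topologically_periodic_at_def)
  \<comment> \<open>Since \<open>x * y * y = y\<close>, this preimage of \<open>U\<close> is a
    neighbourhood of \<open>x\<close>. An n-th power of \<open>x\<close> in it yields the (n-2)-th
    power in \<open>U\<close> once \<open>n > 2\<close>.\<close>
  have "open ((\<lambda>s. s * y * y) -` U)"
    using U by (intro open_vimage continuous_intros)
  then obtain n where n: "n \<ge> 2" "semigroup_power x n * y * y \<in> U"
    using near[of "(\<lambda>s. s * y * y) -` U"] U eqs by auto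
  show thesis
  proof (cases "n = 2")
    case False
    then obtain m where "n = Suc (Suc m)" "m \<ge> 1"
      using n by (metis Suc_1 Suc_le_D Suc_le_mono less_one not_less One_nat_def)
    then show thesis
      using n semigroup_power_times_inverse(1)[OF xy] that by auto
  next
    case True
    have "semigroup_power x 2 * y * y = x * (x * y) * y"
      by (simp add: numeral_2_eq_2 semigroup_power_simps mult.assoc)
    also have "\<dots> = x * y"
      using eqs by (simp flip: mult.assoc)
    finally have "x * y \<in> U" using n True by simp
    moreover have "open ((\<lambda>s. s * y) -` U)"
      using U by (intro open_vimage continuous_intros)
    ultimately obtain k where k: "k \<ge> 2" "semigroup_power x k * y \<in> U"
      using near[of "(\<lambda>s. s * y) -` U"] by auto
    then obtain m where "k = Suc m" "m \<ge> 1"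
      by (cases k) auto
    then show thesis
      using k semigroup_power_times_inverse(2,3)[OF xy] that by auto
  qed
qed

lemma countably_compact_decreasing_closed:
  fixes C :: "nat \<Rightarrow> 'a::topological_space set"
  assumes "countably_compact (UNIV :: 'a set)"
    and "\<And>n. closed (C n)" "\<And>n. C n \<noteq> {}" "\<And>n. C (Suc n) \<subseteq> C n"
  obtains x where "\<And>n. x \<in> C n"
proof (rule ccontr)
  assume "\<not> thesis"
  then have "UNIV \<subseteq> \<Union>(range (\<lambda>n. - C n))"
    using that by auto
  moreover have "countable (range (\<lambda>n. - C n))" "\<forall>V\<in>range (\<lambda>n. - C n). open V"
    using assms(2) by auto
  ultimately obtain T where T: "T \<subseteq> range (\<lambda>n. - C n)" "finite T" "UNIV \<subseteq> \<Union>T"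
    using assms(1) unfolding countably_compact_def by meson
  obtain N where N: "finite N" "T = (\<lambda>n. - C n) ` N"
    using finite_subset_image[OF T(2,1)] by auto
  have dec: "decseq C" using assms(4) by (rule decseq_SucI)
  \<comment> \<open>Inserting \<open>0\<close> keeps \<open>Max\<close> meaningful for empty
    \<open>N\<close>. Points of this smallest set escape every member of \<open>T\<close>.\<close>
  have "C (Max (insert 0 N)) \<subseteq> C n" if "n \<in> N" for n
    using dec N that by (simp add: decseqD)
  moreover obtain z where "z \<in> C (Max (insert 0 N))"
    using assms(3) by blast
  ultimately have "z \<notin> \<Union>T"
    unfolding N(2) by blast
  then show False
    using T(3) by blast
qed

section \<open>Continuity of inversion at idempotents\<close>

lemma inversion_continuous_at_idempotent:
  fixes e :: "'a::topological_semigroup_mult"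
  assumes per: "topologically_periodic TYPE('a)"
    and reg: "inversely_regular_at e"
    and cc: "countably_compact (UNIV :: 'a set)"
    and e: "e \<in> idempotents"
    and U: "open U" "e \<in> U"
  obtains W where "open W" "e \<in> W" "\<And>z. z \<in> W \<inter> clifford_part \<Longrightarrow> inversion z \<in> U"
proof (rule ccontr)
  assume no: "\<not> thesis"
  define I :: "'a set \<Rightarrow> 'a set" where "I V = inversion ` (V \<inter> clifford_part)" for V
  \<comment> \<open>The clause for \<open>n = 0\<close> pins the first neighbourhood to
    \<open>U\<close>, which the final contradiction needs.\<close>
  have "\<exists>f. \<forall>n. ((open (f n) \<and> e \<in> f n) \<and> (n = 0 \<longrightarrow> f n = U)) \<and>
      closure (I (f (Suc n))) \<subseteq> I (f n) \<and> (\<forall>x\<in>f (Suc n). \<forall>y\<in>f (Suc n). x * y \<in> f n)"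
  proof (rule dependent_nat_choice)
    fix V and n :: nat
    assume V: "(open V \<and> e \<in> V) \<and> (n = 0 \<longrightarrow> V = U)"
    obtain X where X: "open X" "e \<in> X" "closure (I X) \<subseteq> I V"
      using reg V unfolding inversely_regular_at_def I_def by blast
    obtain A B where AB: "open A" "open B" "e \<in> A" "e \<in> B"
      "\<And>x y. x \<in> A \<Longrightarrow> y \<in> B \<Longrightarrow> x * y \<in> V"
      using V e open_times_neighbourhoods[of V e e] by (auto simp: idempotents_def)
    have "I (X \<inter> A \<inter> B) \<subseteq> I X" by (auto simp: I_def)
    then have "closure (I (X \<inter> A \<inter> B)) \<subseteq> I V"
      using X closure_mono by blast
    then show "\<exists>V'. ((open V' \<and> e \<in> V') \<and> (Suc n = 0 \<longrightarrow> V' = U)) \<and>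
        closure (I V') \<subseteq> I V \<and> (\<forall>x\<in>V'. \<forall>y\<in>V'. x * y \<in> V)"
      using X AB by (intro exI[of _ "X \<inter> A \<inter> B"]) auto
  qed (use U in auto)
  then obtain W where all: "\<forall>n. ((open (W n) \<and> e \<in> W n) \<and> (n = 0 \<longrightarrow> W n = U)) \<and>
      closure (I (W (Suc n))) \<subseteq> I (W n) \<and> (\<forall>x\<in>W (Suc n). \<forall>y\<in>W (Suc n). x * y \<in> W n)" ..
  then have W: "open (W n)" "e \<in> W n" "W 0 = U"
    and WI: "closure (I (W (Suc n))) \<subseteq> I (W n)"
    and Wm: "\<And>x y. x \<in> W (Suc n) \<Longrightarrow> y \<in> W (Suc n) \<Longrightarrow> x * y \<in> W n" for n
    by simp_all
  have "I (W n) - U \<noteq> {}" for n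
    using no that[of "W n"] W by (auto simp: I_def)
  \<comment> \<open>Closures make these sets closed, as the compactness lemma requires; removing the
    open \<open>U\<close> keeps them closed.\<close>
  then have ne: "closure (I (W n)) - U \<noteq> {}" for n
    using closure_subset[of "I (W n)"] by blast
  obtain x where x: "\<And>n. x \<in> closure (I (W n)) - U"
  proof (rule countably_compact_decreasing_closed[OF cc, of "\<lambda>n. closure (I (W n)) - U"])
    show "closure (I (W (Suc n))) - U \<subseteq> closure (I (W n)) - U" for n
      using WI[of n] closure_subset[of "I (W n)"] by blast
  qed (use ne U closed_Diff in auto)
  \<comment> \<open>The closure at index \<open>Suc n\<close> lies in \<open>I (W n)\<close>, so a
    point of all the closures lies in every \<open>I (W n)\<close>.\<close>
  have inI: "u \<in> clifford_part \<and> inversion u \<in> W n" if "\<And>n. u \<in> closure (I (W n))" for u n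
  proof -
    have "u \<in> I (W n)" using that[of "Suc n"] WI[of n] by blast
    then obtain v where "v \<in> W n" "v \<in> clifford_part" "u = inversion v"
      unfolding I_def by blast
    then show ?thesis by (simp add: inversion_inversion inversion_in_clifford_part)
  qed
  define y where "y = inversion x"
  have xH: "x \<in> clifford_part" and yW: "\<And>n. y \<in> W n"
    using inI[of x] x by (auto simp: y_def)
  have xy: "commuting_inverse x y"
    using commuting_inverse_inversion[OF xH] by (simp add: y_def)
  \<comment> \<open>Each multiplication costs one index, so the induction covers all
    \<open>n\<close> at once.\<close>
  have powW: "semigroup_power y k \<in> W n" if "k \<ge> 1" for k n
    using that
  proof (induction k arbitrary: n rule: dec_induct)
    case base
    then show ?case using yW by (simp add: semigroup_power_simps)
  next
    case (step k)
    then show ?case using Wm yW by (simp add: semigroup_power_Suc)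
  qed
  have powI: "semigroup_power x k \<in> I (W n)" if "k \<ge> 1" for k n
  proof -
    have "semigroup_power y k \<in> W n \<inter> clifford_part"
      "semigroup_power x k = inversion (semigroup_power y k)"
      using commuting_inverse_imp[OF commuting_inverse_sym[OF commuting_inverse_power(1)[OF xy that]]]
        powW[OF that] by simp_all
    then show ?thesis unfolding I_def by (rule rev_image_eqI)
  qed
  have "y \<in> closure (I (W n))" for n
  proof (rule ccontr)
    assume "y \<notin> closure (I (W n))"
    then have "y \<in> - closure (I (W n))" "open (- closure (I (W n)))" by auto
    moreover have "topologically_periodic_at x"
      using per by (simp add: topologically_periodic_def)
    ultimately obtain k where "k \<ge> 1" "semigroup_power x k \<in> - closure (I (W n))"
      using inverse_near_power xy by blast
    then show False
      using powI[of k n] closure_subset by blast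
  qed
  then have "inversion y \<in> W 0" using inI by blast
  then show False
    using x[of 0] W xH by (simp add: y_def inversion_inversion)
qed

section \<open>Continuity on the whole of H(S)\<close>

lemma continuous_on_inversion:
  assumes per: "topologically_periodic TYPE('a::topological_semigroup_mult)"
    and reg: "inversely_regular TYPE('a)"
    and cc: "countably_compact (UNIV :: 'a set)"
  shows "continuous_on (clifford_part :: 'a set) inversion"
  unfolding continuous_on_topological
proof (intro ballI allI impI)
  fix x :: 'a and U
  assume x: "x \<in> clifford_part" and U: "open U" "inversion x \<in> U"
  define y where "y = inversion x"
  have xy: "commuting_inverse x y"
    using commuting_inverse_inversion[OF x] by (simp add: y_def)
  define e where "e = x * y"
  have e: "e \<in> idempotents"
    using projection_in_idempotents[OF x] by (simp add: e_def y_def projection_def)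
  have ye: "y * e = y" and yx: "y * x = e"
    using xy by (auto simp: e_def commuting_inverse_def mult.assoc)
  \<comment> \<open>Split \<open>y = y * e\<close>: \<open>A\<close> will receive the k-th power of
    \<open>z\<close>, and \<open>B\<close> the inverse of its (k+1)-st power.\<close>
  obtain A B where AB: "open A" "open B" "y \<in> A" "e \<in> B" "\<And>u v. u \<in> A \<Longrightarrow> v \<in> B \<Longrightarrow> u * v \<in> U"
    using open_times_neighbourhoods[of U y e] U ye by (auto simp: y_def)
  have "inversely_regular_at e"
    using reg e by (simp add: inversely_regular_def)
  then obtain D where D: "open D" "e \<in> D" "\<And>z. z \<in> D \<inter> clifford_part \<Longrightarrow> inversion z \<in> B"
    using inversion_continuous_at_idempotent[OF per _ cc e AB(2,4)] by blast
  have "open (A \<inter> (\<lambda>s. s * x) -` D)"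
    using AB D by (intro open_Int open_vimage continuous_intros)
  moreover have "topologically_periodic_at x"
    using per by (simp add: topologically_periodic_def)
  moreover have "y \<in> A \<inter> (\<lambda>s. s * x) -` D"
    using AB D yx by simp
  ultimately obtain k where "k \<ge> 1" "semigroup_power x k \<in> A \<inter> (\<lambda>s. s * x) -` D"
    using inverse_near_power[OF _ xy] by blast
  then have k: "k \<ge> 1" "semigroup_power x k \<in> A" "semigroup_power x k * x \<in> D"
    by auto
  \<comment> \<open>With \<open>k\<close> fixed by \<open>x\<close>, both conditions are open in
    \<open>s\<close>.\<close>
  let ?O = "(\<lambda>s. semigroup_power s k) -` A \<inter> (\<lambda>s. semigroup_power s k * s) -` D"
  have "open ?O"
    using AB D k
    by (intro open_Int open_vimage continuous_on_mult' continuous_on_semigroup_power continuous_on_id)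
  moreover have "x \<in> ?O" using k by simp
  moreover have "inversion z \<in> U" if z: "z \<in> clifford_part" "z \<in> ?O" for z
  proof -
    define w where "w = inversion z"
    have zw: "commuting_inverse z w"
      using commuting_inverse_inversion[OF z(1)] by (simp add: w_def)
    have k1: "Suc k \<ge> 1" by simp
    have eqs: "z * w = w * z" "w * z * w = w"
      using zw by (auto simp: commuting_inverse_def)
    have pow: "semigroup_power z (Suc k) = semigroup_power z k * z"
      using semigroup_power_commute[OF k(1), of z z] k by (simp add: semigroup_power_Suc)
    have inv: "semigroup_power z (Suc k) \<in> clifford_part"
      "inversion (semigroup_power z (Suc k)) = semigroup_power w (Suc k)"
      using commuting_inverse_imp[OF commuting_inverse_power(1)[OF zw k1]] by auto
    then have "semigroup_power w (Suc k) \<in> B"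
      using D(3)[of "semigroup_power z (Suc k)"] z(2) pow by simp
    then have "semigroup_power z k * semigroup_power w (Suc k) \<in> U"
      using AB(5) z(2) by simp
    moreover have "semigroup_power w (Suc k) = semigroup_power w k * w"
      using semigroup_power_commute[OF k(1), of w w] k by (simp add: semigroup_power_Suc)
    \<comment> \<open>The k-th powers of \<open>z\<close> and \<open>w\<close> multiply to
      \<open>z * w\<close>, leaving \<open>z * w * w = w\<close>.\<close>
    then have "semigroup_power z k * semigroup_power w (Suc k) = w"
      using commuting_inverse_power(2)[OF zw k(1)] eqs by (simp flip: mult.assoc)
    ultimately show ?thesis by (simp add: w_def)
  qed
  ultimately show "\<exists>V. open V \<and> x \<in> V \<and> (\<forall>z\<in>clifford_part. z \<in> V \<longrightarrow> inversion z \<in> U)"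
    by blast
qed

theorem theorem9:
  assumes "topologically_periodic TYPE('a::{t2_space, topological_semigroup_mult})"
    and "inversely_regular TYPE('a)"
    and "countably_compact (UNIV :: 'a set)"
  shows "continuous_map (top_of_set (clifford_part :: 'a set)) (top_of_set clifford_part) inversion \<and>
         continuous_map (top_of_set (clifford_part :: 'a set)) (top_of_set idempotents) projection"
proof -
  have inv: "continuous_on (clifford_part :: 'a set) inversion"
    by (rule continuous_on_inversion[OF assms])
  then have "continuous_on (clifford_part :: 'a set) projection"
    unfolding projection_def[abs_def] by (intro continuous_on_mult' continuous_on_id)
  with inv show ?thesis
    by (auto simp: inversion_in_clifford_part projection_in_idempotents)
qed

end
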